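(* Let $(S,A)$ be a physical model with finitely many observable quantities. Then: (1) $(S,A)$ is observationally equivalent to a physical model in normal form; (2) $(S,A)$ is isomorphic to a physical model in normal form if and only if $(S,A)$ is reduced.
   Context: A physical model is a pair $(S,A)$ where $S$ is a set of states and $A$ is a set of functions from $S$ to $\mathbb{R}$ (observable quantities). Isomorphism: bijections $\phi:S\to T$, $\psi:A\to B$ with $\alpha(s)=\psi(\alpha)(\phi(s))$ for all $s\in S,\alpha\in A$. $(S,A)$ is reduced iff for distinct $s_1,s_2\in S$ some $\alpha\in A$ has $\alpha(s_1)\ne\alpha(s_2)$. An epimorphism from $(S,A)$ to $(T,B)$ is a pair $(\phi,\psi)$, $\phi:S\to T$ surjective, $\psi:A\to B$ bijective, with $\alpha(s)=\psi(\alpha)(\phi(s))$. Two physical models are observationally equivalent iff both admit epimorphisms onto a common reduced physical model. Let $\varpi_i^n:\mathbb{R}^n\to\mathbb{R}$ denote the Cartesian projection $\varpi_i^n(x_1,\dots,x_n)=x_i$. A physical model $(S,A)$ with finitely many observable quantities is in normal form iff $S\subseteq\mathbb{R}^n$ and $A=\{\varpi_1^n,\dots,\varpi_n^n\}$ for some $n$ (restricted to $S$). *)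

theory Defs
  imports Complex_Main "HOL-Library.FuncSet"
begin

text \<open>
  Functions on a set of states are extensional (\<open>undefined\<close> outside \<open>S\<close>), so that equality
  of observable quantities is equality of functions with domain \<open>S\<close>.
\<close>

definition physical_model :: "'s set \<Rightarrow> ('s \<Rightarrow> real) set \<Rightarrow> bool" where
  "physical_model S A \<longleftrightarrow> A \<subseteq> (S \<rightarrow>\<^sub>E UNIV)"

definition isomorphic_models ::
  "'s set \<Rightarrow> ('s \<Rightarrow> real) set \<Rightarrow> 't set \<Rightarrow> ('t \<Rightarrow> real) set \<Rightarrow> bool" where
  "isomorphic_models S A T B \<longleftrightarrow>
     (\<exists>\<phi> \<psi>. bij_betw \<phi> S T \<and> bij_betw \<psi> A B \<and> (\<forall>s\<in>S. \<forall>\<alpha>\<in>A. \<alpha> s = \<psi> \<alpha> (\<phi> s)))"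

definition reduced_model :: "'s set \<Rightarrow> ('s \<Rightarrow> real) set \<Rightarrow> bool" where
  "reduced_model S A \<longleftrightarrow> (\<forall>s\<^sub>1\<in>S. \<forall>s\<^sub>2\<in>S. s\<^sub>1 \<noteq> s\<^sub>2 \<longrightarrow> (\<exists>\<alpha>\<in>A. \<alpha> s\<^sub>1 \<noteq> \<alpha> s\<^sub>2))"

definition epimorphism ::
  "('s \<Rightarrow> 't) \<Rightarrow> (('s \<Rightarrow> real) \<Rightarrow> ('t \<Rightarrow> real)) \<Rightarrow>
   's set \<Rightarrow> ('s \<Rightarrow> real) set \<Rightarrow> 't set \<Rightarrow> ('t \<Rightarrow> real) set \<Rightarrow> bool" where
  "epimorphism \<phi> \<psi> S A T B \<longleftrightarrow>
     \<phi> ` S = T \<and> bij_betw \<psi> A B \<and> (\<forall>s\<in>S. \<forall>\<alpha>\<in>A. \<alpha> s = \<psi> \<alpha> (\<phi> s))"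

text \<open>
  HOL cannot quantify over the type of the states of the common reduced model. Taking it to be
  the state type of the first model loses no generality, because the common model is a
  surjective image of \<open>S\<close>: lemma \<open>observationally_equivalentI\<close> below accepts a common
  reduced model over an arbitrary type.
\<close>

definition observationally_equivalent ::
  "'s set \<Rightarrow> ('s \<Rightarrow> real) set \<Rightarrow> 't set \<Rightarrow> ('t \<Rightarrow> real) set \<Rightarrow> bool" where
  "observationally_equivalent S A T B \<longleftrightarrow>
     (\<exists>(U :: 's set) C. physical_model U C \<and> reduced_model U C \<and>
        (\<exists>\<phi> \<psi>. epimorphism \<phi> \<psi> S A U C) \<and> (\<exists>\<phi> \<psi>. epimorphism \<phi> \<psi> T B U C))"

lemma observationally_equivalentI:
  fixes S :: "'s set" and T :: "'t set" and U :: "'u set"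
  assumes U: "physical_model U C" "reduced_model U C"
    and S: "epimorphism \<phi> \<psi> S A U C"
    and T: "epimorphism \<phi>' \<psi>' T B U C"
  shows "observationally_equivalent S A T B"
proof -
  define g where "g = inv_into S \<phi>"
  define h where "h \<gamma> = restrict (\<gamma> \<circ> \<phi>) (g ` U)" for \<gamma> :: "'u \<Rightarrow> real"
  have \<phi>g: "\<phi> (g u) = u" if "u \<in> U" for u
    using S that unfolding g_def epimorphism_def by (metis f_inv_into_f)
  have hg: "h \<gamma> (g u) = \<gamma> u" if "u \<in> U" for \<gamma> u
    using that by (simp add: h_def \<phi>g)
  have "inj_on h C"
  proof (rule inj_onI)
    fix \<gamma> \<delta> assume *: "\<gamma> \<in> C" "\<delta> \<in> C" "h \<gamma> = h \<delta>"
    show "\<gamma> = \<delta>"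
    proof (rule extensionalityI[of _ U])
      show "\<gamma> \<in> extensional U" "\<delta> \<in> extensional U"
        using * U(1) by (auto simp: physical_model_def PiE_def)
      show "\<gamma> u = \<delta> u" if "u \<in> U" for u
        using hg[OF that, of \<gamma>] hg[OF that, of \<delta>] * by simp
    qed
  qed
  then have h: "bij_betw h C (h ` C)"
    by (simp add: bij_betw_def)
  have "physical_model (g ` U) (h ` C)"
    by (auto simp: physical_model_def h_def)
  moreover have "reduced_model (g ` U) (h ` C)"
    unfolding reduced_model_def
  proof (intro ballI impI)
    fix s t assume "s \<in> g ` U" "t \<in> g ` U" "s \<noteq> t"
    then obtain u v where uv: "u \<in> U" "v \<in> U" "s = g u" "t = g v" "u \<noteq> v"
      by blast
    with U(2) obtain \<gamma> where "\<gamma> \<in> C" "\<gamma> u \<noteq> \<gamma> v"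
      unfolding reduced_model_def by blast
    then show "\<exists>\<alpha>\<in>h ` C. \<alpha> s \<noteq> \<alpha> t"
      using uv by (auto simp: hg)
  qed
  moreover have "epimorphism (g \<circ> p) (h \<circ> q) R D (g ` U) (h ` C)"
    if "epimorphism p q R D U C" for p q and R :: "'r set" and D
    unfolding epimorphism_def
  proof (intro conjI ballI)
    show "(g \<circ> p) ` R = g ` U"
      using that unfolding epimorphism_def by (metis image_comp)
    show "bij_betw (h \<circ> q) D (h ` C)"
      using that h by (intro bij_betw_trans[of q D C]) (simp_all add: epimorphism_def)
    show "\<alpha> s = (h \<circ> q) \<alpha> ((g \<circ> p) s)" if "s \<in> R" "\<alpha> \<in> D" for s \<alpha>
    proof -
      from \<open>epimorphism p q R D U C\<close> that have "p s \<in> U" "\<alpha> s = q \<alpha> (p s)"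
        unfolding epimorphism_def by blast+
      then show ?thesis
        by (simp add: hg)
    qed
  qed
  ultimately show ?thesis
    using S T unfolding observationally_equivalent_def by metis
qed

text \<open>
  The space \<open>\<real>\<^sup>n\<close>, for a natural number \<open>n\<close> that may be \<open>0\<close>, consists of the
  extensional functions on \<open>{1..n}\<close>. The case \<open>n = 0\<close> (a single point, no projections) is needed
  for models without observable quantities.
\<close>

definition real_space :: "nat \<Rightarrow> (nat \<Rightarrow> real) set" where
  "real_space n = ({1..n} \<rightarrow>\<^sub>E UNIV)"

definition projection :: "nat \<Rightarrow> (nat \<Rightarrow> real) \<Rightarrow> real" where
  "projection i x = x i"

definition normal_form :: "(nat \<Rightarrow> real) set \<Rightarrow> ((nat \<Rightarrow> real) \<Rightarrow> real) set \<Rightarrow> bool" where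
  "normal_form S A \<longleftrightarrow>
     (\<exists>n. S \<subseteq> real_space n \<and> A = (\<lambda>i. restrict (projection i) S) ` {1..n})"

end

theory Submission
  imports Defs
begin

text \<open>
  Enumerate the observables as \<open>\<alpha>\<^sub>1, \<dots>, \<alpha>\<^sub>n\<close> without repetition. The measurement map
  \<open>s \<mapsto> (\<alpha>\<^sub>1 s, \<dots>, \<alpha>\<^sub>n s)\<close> sends \<open>\<alpha>\<^sub>i\<close> to the \<open>i\<close>-th projection and
  is an epimorphism onto a model in normal form; it is injective exactly if the model is reduced.
\<close>

lemma normal_form_reduced:
  assumes "normal_form T B"
  shows "reduced_model T B"
  unfolding reduced_model_def
proof (intro ballI impI)
  fix x y assume xy: "x \<in> T" "y \<in> T" "x \<noteq> y"
  from assms obtain n where T: "T \<subseteq> real_space n"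
    and B: "B = (\<lambda>i. restrict (projection i) T) ` {1..n}"
    unfolding normal_form_def by blast
  have "x \<in> {1..n} \<rightarrow>\<^sub>E UNIV" "y \<in> {1..n} \<rightarrow>\<^sub>E UNIV"
    using T xy by (auto simp: real_space_def)
  \<comment> \<open>Both points are \<open>undefined\<close> outside \<open>{1..n}\<close>, so
    distinct points must differ in a genuine coordinate, and the projection to that coordinate
    separates them.\<close>
  with xy obtain i where "i \<in> {1..n}" "x i \<noteq> y i"
    by (metis PiE_ext)
  with xy B show "\<exists>\<beta>\<in>B. \<beta> x \<noteq> \<beta> y"
    by (auto simp: projection_def)
qed

lemma normal_form_epimorphism:
  assumes "physical_model S A" and "finite A"
  obtains \<phi> \<psi> T B where "physical_model T B" "normal_form T B" "epimorphism \<phi> \<psi> S A T B"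
proof -
  obtain e where e: "bij_betw e {1..card A} A"
    using ex_bij_betw_nat_finite_1[OF assms(2)] by blast
  \<comment> \<open>Restricting to the index set makes \<open>\<phi> s\<close> a point of
    \<open>real_space (card A)\<close>. If \<open>A\<close> is empty, all states go to the single
    point of \<open>real_space 0\<close>.\<close>
  define \<phi> where "\<phi> s = (\<lambda>i\<in>{1..card A}. e i s)" for s
  define T where "T = \<phi> ` S"
  define P where "P i = restrict (projection i) T" for i
  define B where "B = P ` {1..card A}"
  define \<psi> where "\<psi> = P \<circ> inv_into {1..card A} e"
  have P\<phi>: "P i (\<phi> s) = e i s" if "s \<in> S" "i \<in> {1..card A}" for s i
    using that by (simp add: P_def T_def projection_def \<phi>_def)
  \<comment> \<open>Distinct projections could coincide once restricted to a small \<open>T\<close>.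
    Here they do not: since \<open>T\<close> is the image of \<open>S\<close>, equality of
    \<open>P i\<close> and \<open>P j\<close> forces \<open>e i\<close> and \<open>e j\<close> to
    agree on \<open>S\<close>, hence everywhere by extensionality, and \<open>e\<close> is
    injective.\<close>
  have "inj_on P {1..card A}"
  proof (rule inj_onI)
    fix i j assume ij: "i \<in> {1..card A}" "j \<in> {1..card A}" "P i = P j"
    have "e i \<in> A" "e j \<in> A"
      using e ij by (auto simp: bij_betw_def)
    then have "e i \<in> S \<rightarrow>\<^sub>E UNIV" "e j \<in> S \<rightarrow>\<^sub>E UNIV"
      using assms(1) by (auto simp: physical_model_def)
    then have "e i = e j"
      by (rule PiE_ext) (metis P\<phi> ij)
    with e ij show "i = j"
      by (meson bij_betw_imp_inj_on inj_onD)
  qed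
  then have \<psi>: "bij_betw \<psi> A B"
    unfolding \<psi>_def B_def
    by (intro bij_betw_trans[OF bij_betw_inv_into[OF e]]) (simp add: bij_betw_def)
  have "\<alpha> s = \<psi> \<alpha> (\<phi> s)" if "s \<in> S" "\<alpha> \<in> A" for s \<alpha>
  proof -
    have "inv_into {1..card A} e \<alpha> \<in> {1..card A}"
      using bij_betw_apply[OF bij_betw_inv_into[OF e] that(2)] .
    then show ?thesis
      using P\<phi>[OF that(1)] bij_betw_inv_into_right[OF e that(2)] by (simp add: \<psi>_def)
  qed
  with \<psi> have "epimorphism \<phi> \<psi> S A T B"
    by (simp add: epimorphism_def T_def)
  moreover have "normal_form T B"
    unfolding normal_form_def
    by (rule exI[of _ "card A"]) (auto simp: T_def \<phi>_def real_space_def B_def P_def)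
  moreover have "physical_model T B"
    by (auto simp: physical_model_def B_def P_def)
  ultimately show thesis
    using that by blast
qed

lemma epimorphism_id: "epimorphism id id S A S A"
  by (simp add: epimorphism_def)

text \<open>Only injectivity of \<open>\<phi>\<close> is missing. States with the same image under
  \<open>\<phi>\<close> give the same value to every observable of \<open>A\<close>, so they
  coincide in a reduced model.\<close>

lemma reduced_epimorphism_imp_isomorphic:
  assumes "reduced_model S A" and "epimorphism \<phi> \<psi> S A T B"
  shows "isomorphic_models S A T B"
proof -
  have "inj_on \<phi> S"
    using assms unfolding inj_on_def reduced_model_def epimorphism_def by metis
  with assms(2) show ?thesis
    unfolding isomorphic_models_def epimorphism_def bij_betw_def by blast
qed

text \<open>Injectivity of \<open>\<phi>\<close> keeps distinct states distinct in \<open>T\<close>;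
  an observable separating their images is \<open>\<psi> \<alpha>\<close> for some
  \<open>\<alpha>\<close> in \<open>A\<close>, which then separates the original states.\<close>

lemma isomorphic_reduced:
  assumes "isomorphic_models S A T B" and "reduced_model T B"
  shows "reduced_model S A"
  unfolding reduced_model_def
proof (intro ballI impI)
  fix s t assume st: "s \<in> S" "t \<in> S" "s \<noteq> t"
  from assms(1) obtain \<phi> \<psi> where \<phi>: "bij_betw \<phi> S T" and \<psi>: "bij_betw \<psi> A B"
    and eq: "\<forall>s\<in>S. \<forall>\<alpha>\<in>A. \<alpha> s = \<psi> \<alpha> (\<phi> s)"
    unfolding isomorphic_models_def by blast
  have "\<phi> s \<in> T" "\<phi> t \<in> T" "\<phi> s \<noteq> \<phi> t"
    using \<phi> st by (auto simp: bij_betw_def inj_on_def)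
  with assms(2) obtain \<beta> where "\<beta> \<in> B" "\<beta> (\<phi> s) \<noteq> \<beta> (\<phi> t)"
    unfolding reduced_model_def by blast
  with \<psi> st eq show "\<exists>\<alpha>\<in>A. \<alpha> s \<noteq> \<alpha> t"
    unfolding bij_betw_def by (metis imageE)
qed

theorem theorem12:
  fixes S :: "'s set" and A :: "('s \<Rightarrow> real) set"
  assumes "physical_model S A" and "finite A"
  shows "(\<exists>T B. physical_model T B \<and> normal_form T B \<and> observationally_equivalent S A T B) \<and>
         ((\<exists>T B. physical_model T B \<and> normal_form T B \<and> isomorphic_models S A T B)
            \<longleftrightarrow> reduced_model S A)"
proof -
  obtain \<phi> \<psi> T B where *: "physical_model T B" "normal_form T B" "epimorphism \<phi> \<psi> S A T B"
    using normal_form_epimorphism[OF assms] by metis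
  \<comment> \<open>The normal form, being reduced, serves as the common reduced model itself,
    reached from \<open>T\<close> by the identity.\<close>
  have "observationally_equivalent S A T B"
    using observationally_equivalentI[OF *(1) normal_form_reduced[OF *(2)] *(3) epimorphism_id] .
  with * show ?thesis
    using reduced_epimorphism_imp_isomorphic isomorphic_reduced normal_form_reduced by metis
qed

end
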